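(* Let $\{\tilde{\mathbf b}^t\}_{t\ge 0}$ be the minimizer of the aggregate problem $$\tilde\phi:=\min_{\{\mathbf b^t\}} F(\{\mathbf b^t\})$$ over all charging sequences that are feasible (i.e., that satisfy constraints (i)–(v) of the context for all users and all $t$). Then $\{\tilde{\mathbf b}^t\}$ is a generalized Nash equilibrium of the $N$-user voltage-constrained game in which user $n$ minimizes $F_n$. That is, $\{\tilde{\mathbf b}^t\}$ is feasible and, for every $n\in\{1,\dots,N\}$, $$F_n(\{\tilde b_n^t,\tilde{\mathbf b}_{-n}^t\})\le F_n(\{\breve b_n^t,\tilde{\mathbf b}_{-n}^t\})$$ for every sequence $\{\breve b_n^t\}$ such that the charging sequence $\{(\breve b_n^t,\tilde{\mathbf b}_{-n}^t)\}$ is feasible.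
   Context: Setting. There are $N$ users (one per bus of a radial distribution grid), indexed by $n$, and time periods $t=0,1,2,\dots$. Vector inequalities are entrywise, and $\mathbf 1$ is the all-one vector. At time $t$: $\boldsymbol\ell^t,\mathbf q^t\in\mathbb R^N$ are the (random) active and reactive loads, with $\underline{\boldsymbol\ell}\le\boldsymbol\ell^t\le\overline{\boldsymbol\ell}$ and $\underline{\mathbf q}\le\mathbf q^t\le\overline{\mathbf q}$; $r^t\in\{-1,+1\}$ is the regulation signal; the prices satisfy $0\le\underline c_0\le c_0^t\le\overline c_0$, $0\le\underline c_p\le c_p^t\le\overline c_p$, $0\le\underline c_r\le c_r^t\le\overline c_r$. The quantities $\{r^t,c_0^t,c_p^t,c_r^t,\boldsymbol\ell^t,\mathbf q^t\}$ are random variables. The decisions are the battery charges $\mathbf b^t=(b_1^t,\dots,b_N^t)$ (possibly random); $\mathbf b_{-n}^t$ denotes the decisions of all users but $n$. The initial states of charge $\mathbf s^0\in[\underline{\mathbf s},\overline{\mathbf s}]$ are given. The matrices are $\mathbf R=2(\mathbf A^\top \mathrm{diag}(\rho)^{-1}\mathbf A)^{-1}$ and $\mathbf X=2(\mathbf A^\top \mathrm{diag}(\chi)^{-1}\mathbf A)^{-1}$, where $\mathbf A$ is the (square, invertible) reduced branch-bus incidence matrix of the radial grid and $\rho,\chi$ are the vectors of line resistances and reactances; $\mathbf R,\mathbf X$ have nonnegative entries. The scalars $\alpha,\beta$ are fixed voltage limits. Constraints. A charging sequence $\{\mathbf b^t\}$ is feasible if for all $t$: (i) $\mathbf s^{t+1}=\mathbf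 s^t+\mathbf b^t$ and $\underline{\mathbf s}\le\mathbf s^t\le\overline{\mathbf s}$; (ii) $\underline{\mathbf b}\le\mathbf b^t\le\overline{\mathbf b}$; (iii) $\mathbf p^t=\boldsymbol\ell^t+\mathbf b^t$ (net active demand); (iv) voltage regulation: $\alpha\mathbf 1\le-\mathbf R\mathbf p^t-\mathbf X\mathbf q^t\le\beta\mathbf 1$; (v) sign constraint: each $b_n^t$ is either zero or has the sign of $r^t$, i.e. $r^tb_n^t\ge 0$ for all $n$. Costs. The cost of user $n$ at time $t$ is $$f_n^t(b_n^t,\mathbf b_{-n}^t)=\Big(c_0^t+c_p^t\sum_{i=1}^Np_i^t\Big)p_n^t-r^tc_r^tb_n^t,$$ and its time-averaged expected cost is $F_n(\{b_n^t,\mathbf b_{-n}^t\})=\lim_{T\to\infty}\frac1T\sum_{t=0}^{T-1}\mathbb E[f_n^t(b_n^t,\mathbf b_{-n}^t)]$. The aggregate cost at time $t$ is $$f^t(\mathbf b^t)=\frac{c_p^t}{2}\Big(\sum_{n=1}^Np_n^t\Big)^2+\sum_{n=1}^N\Big[c_0^tp_n^t+\frac{c_p^t(p_n^t)^2}{2}-r^tc_r^tb_n^t\Big],$$ and $F(\{\mathbf b^t\})=\lim_{T\to\infty}\frac1T\sum_{t=0}^{T-1}\mathbb E[f^t(\mathbf b^t)]$. The limits defining $F_n$ and $F$ are understood to exist for the sequences considered. In the game, user $n$ minimizes $F_n$ over $\{b_n^t\}$ subject to its own battery constraints and sign constraint and to the shared voltage constraint (iv). *)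

theory Defs
  imports "HOL-Probability.Probability"
begin

(* Users (non-substation buses) are the elements of the finite type 'n, so that vectors in R^N
   are real^'n and the vector order is entrywise. Buses are elements of 'n option, with None the
   substation. A radial grid has as many lines as users, so lines are indexed by 'n as well;
   line e joins the buses line_from e and line_to e. The sample space is 'w. *)

record ('w, 'n::finite) storage_game =
  sample_space :: "'w measure"
  line_from :: "'n \<Rightarrow> 'n option"
  line_to :: "'n \<Rightarrow> 'n option"
  resistance :: "real ^ 'n"
  reactance :: "real ^ 'n"
  v_min :: real
  v_max :: real
  s_init :: "real ^ 'n"
  s_min :: "real ^ 'n"
  s_max :: "real ^ 'n"
  b_min :: "real ^ 'n"
  b_max :: "real ^ 'n"
  l_min :: "real ^ 'n"
  l_max :: "real ^ 'n"
  q_min :: "real ^ 'n"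
  q_max :: "real ^ 'n"
  c0_min :: real
  c0_max :: real
  cp_min :: real
  cp_max :: real
  cr_min :: real
  cr_max :: real
  active_load :: "nat \<Rightarrow> 'w \<Rightarrow> real ^ 'n"
  reactive_load :: "nat \<Rightarrow> 'w \<Rightarrow> real ^ 'n"
  regulation :: "nat \<Rightarrow> 'w \<Rightarrow> real"
  c0 :: "nat \<Rightarrow> 'w \<Rightarrow> real"
  cp :: "nat \<Rightarrow> 'w \<Rightarrow> real"
  cr :: "nat \<Rightarrow> 'w \<Rightarrow> real"

type_synonym ('w, 'n) charging = "nat \<Rightarrow> 'w \<Rightarrow> real ^ 'n"


definition adjacent_via :: "('w, 'n::finite) storage_game \<Rightarrow> 'n set \<Rightarrow> ('n option \<times> 'n option) set" where
  "adjacent_via G E =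
     {(line_from G e, line_to G e) | e. e \<in> E} \<union> {(line_to G e, line_from G e) | e. e \<in> E}"

(* The grid is a tree: every two buses are connected, and no line closes a loop, i.e. the two
   ends of a line are not connected by the remaining lines (this also excludes self-loops and
   parallel lines). *)
definition radial :: "('w, 'n::finite) storage_game \<Rightarrow> bool" where
  "radial G \<longleftrightarrow>
     (\<forall>i j. (i, j) \<in> (adjacent_via G UNIV)\<^sup>*) \<and>
     (\<forall>e. (line_from G e, line_to G e) \<notin> (adjacent_via G (UNIV - {e}))\<^sup>*)"

(* Rows are lines, columns are buses; the column of the substation is deleted. *)
definition reduced_incidence :: "('w, 'n::finite) storage_game \<Rightarrow> real ^ 'n ^ 'n" where
  "reduced_incidence G =
     (\<chi> e i. (if line_from G e = Some i then 1 else 0) - (if line_to G e = Some i then 1 else 0))"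

definition diag :: "real ^ 'n \<Rightarrow> real ^ 'n ^ 'n" where
  "diag v = (\<chi> i j. if i = j then v $ i else 0)"

definition sensitivity :: "('w, 'n::finite) storage_game \<Rightarrow> real ^ 'n \<Rightarrow> real ^ 'n ^ 'n" where
  "sensitivity G z =
     2 *\<^sub>R matrix_inv
       (transpose (reduced_incidence G) ** matrix_inv (diag z) ** reduced_incidence G)"

definition R_mat :: "('w, 'n::finite) storage_game \<Rightarrow> real ^ 'n ^ 'n" where
  "R_mat G = sensitivity G (resistance G)"

definition X_mat :: "('w, 'n::finite) storage_game \<Rightarrow> real ^ 'n ^ 'n" where
  "X_mat G = sensitivity G (reactance G)"

(* Invertibility of the incidence matrix already follows from radiality; likewise the entries of
   R and X are nonnegative whenever all resistances and reactances are positive. *)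
definition valid_grid :: "('w, 'n::finite) storage_game \<Rightarrow> bool" where
  "valid_grid G \<longleftrightarrow>
     radial G \<and> invertible (reduced_incidence G) \<and>
     (\<forall>e. resistance G $ e \<noteq> 0) \<and> (\<forall>e. reactance G $ e \<noteq> 0) \<and>
     (\<forall>i j. 0 \<le> R_mat G $ i $ j) \<and> (\<forall>i j. 0 \<le> X_mat G $ i $ j)"

(* Constraints between random quantities are understood almost surely, throughout. *)
definition valid_data :: "('w, 'n::finite) storage_game \<Rightarrow> bool" where
  "valid_data G \<longleftrightarrow>
     prob_space (sample_space G) \<and>
     s_min G \<le> s_init G \<and> s_init G \<le> s_max G \<and>
     0 \<le> c0_min G \<and> 0 \<le> cp_min G \<and> 0 \<le> cr_min G \<and>
     (\<forall>t. active_load G t \<in> borel_measurable (sample_space G) \<and>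
          reactive_load G t \<in> borel_measurable (sample_space G) \<and>
          regulation G t \<in> borel_measurable (sample_space G) \<and>
          c0 G t \<in> borel_measurable (sample_space G) \<and>
          cp G t \<in> borel_measurable (sample_space G) \<and>
          cr G t \<in> borel_measurable (sample_space G)) \<and>
     (AE w in sample_space G. \<forall>t.
          l_min G \<le> active_load G t w \<and> active_load G t w \<le> l_max G \<and>
          q_min G \<le> reactive_load G t w \<and> reactive_load G t w \<le> q_max G \<and>
          regulation G t w \<in> {-1, 1} \<and>
          c0_min G \<le> c0 G t w \<and> c0 G t w \<le> c0_max G \<and>
          cp_min G \<le> cp G t w \<and> cp G t w \<le> cp_max G \<and>
          cr_min G \<le> cr G t w \<and> cr G t w \<le> cr_max G)"


primrec charge_state :: "('w, 'n::finite) storage_game \<Rightarrow> ('w, 'n) charging \<Rightarrow> nat \<Rightarrow> 'w \<Rightarrow> real ^ 'n" where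
  "charge_state G b 0 w = s_init G"
| "charge_state G b (Suc t) w = charge_state G b t w + b t w"

definition net_demand :: "('w, 'n::finite) storage_game \<Rightarrow> ('w, 'n) charging \<Rightarrow> nat \<Rightarrow> 'w \<Rightarrow> real ^ 'n" where
  "net_demand G b t w = active_load G t w + b t w"

(* Charging decisions are arbitrary random vectors on the common sample space; no causality
   (adaptedness) requirement is imposed. *)
definition feasible :: "('w, 'n::finite) storage_game \<Rightarrow> ('w, 'n) charging \<Rightarrow> bool" where
  "feasible G b \<longleftrightarrow>
     (\<forall>t. b t \<in> borel_measurable (sample_space G)) \<and>
     (AE w in sample_space G. \<forall>t.
        s_min G \<le> charge_state G b t w \<and> charge_state G b t w \<le> s_max G \<and>
        b_min G \<le> b t w \<and> b t w \<le> b_max G \<and>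
        vec (v_min G) \<le> - (R_mat G *v net_demand G b t w) - X_mat G *v reactive_load G t w \<and>
        - (R_mat G *v net_demand G b t w) - X_mat G *v reactive_load G t w \<le> vec (v_max G) \<and>
        (\<forall>n. 0 \<le> regulation G t w * b t w $ n))"


definition user_cost ::
  "('w, 'n::finite) storage_game \<Rightarrow> 'n \<Rightarrow> ('w, 'n) charging \<Rightarrow> nat \<Rightarrow> 'w \<Rightarrow> real" where
  "user_cost G n b t w =
     (c0 G t w + cp G t w * (\<Sum>i\<in>UNIV. net_demand G b t w $ i)) * net_demand G b t w $ n
     - regulation G t w * cr G t w * b t w $ n"

definition aggregate_cost ::
  "('w, 'n::finite) storage_game \<Rightarrow> ('w, 'n) charging \<Rightarrow> nat \<Rightarrow> 'w \<Rightarrow> real" where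
  "aggregate_cost G b t w =
     cp G t w / 2 * (\<Sum>n\<in>UNIV. net_demand G b t w $ n)\<^sup>2
     + (\<Sum>n\<in>UNIV. c0 G t w * net_demand G b t w $ n
                  + cp G t w * (net_demand G b t w $ n)\<^sup>2 / 2
                  - regulation G t w * cr G t w * b t w $ n)"

definition mean_cost ::
  "('w, 'n::finite) storage_game \<Rightarrow> (nat \<Rightarrow> 'w \<Rightarrow> real) \<Rightarrow> nat \<Rightarrow> real" where
  "mean_cost G f T = (1 / real T) * (\<Sum>t<T. integral\<^sup>L (sample_space G) (f t))"

(* The value of lim is meaningful only if the sequence converges, so uses of F_user and F_agg are
   accompanied by the predicates below. *)
definition F_user :: "('w, 'n::finite) storage_game \<Rightarrow> 'n \<Rightarrow> ('w, 'n) charging \<Rightarrow> real" where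
  "F_user G n b = lim (mean_cost G (user_cost G n b))"

definition F_agg :: "('w, 'n::finite) storage_game \<Rightarrow> ('w, 'n) charging \<Rightarrow> real" where
  "F_agg G b = lim (mean_cost G (aggregate_cost G b))"

definition F_user_exists :: "('w, 'n::finite) storage_game \<Rightarrow> 'n \<Rightarrow> ('w, 'n) charging \<Rightarrow> bool" where
  "F_user_exists G n b \<longleftrightarrow> convergent (mean_cost G (user_cost G n b))"

definition F_agg_exists :: "('w, 'n::finite) storage_game \<Rightarrow> ('w, 'n) charging \<Rightarrow> bool" where
  "F_agg_exists G b \<longleftrightarrow> convergent (mean_cost G (aggregate_cost G b))"


definition aggregate_minimizer ::
  "('w, 'n::finite) storage_game \<Rightarrow> ('w, 'n) charging \<Rightarrow> bool" where
  "aggregate_minimizer G b \<longleftrightarrow>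
     feasible G b \<and> F_agg_exists G b \<and>
     (\<forall>b'. feasible G b' \<and> F_agg_exists G b' \<longrightarrow> F_agg G b \<le> F_agg G b')"

definition deviate ::
  "('w, 'n::finite) charging \<Rightarrow> 'n \<Rightarrow> (nat \<Rightarrow> 'w \<Rightarrow> real) \<Rightarrow> ('w, 'n) charging" where
  "deviate b n d = (\<lambda>t w. \<chi> i. if i = n then d t w else b t w $ i)"

definition generalized_nash_equilibrium ::
  "('w, 'n::finite) storage_game \<Rightarrow> ('w, 'n) charging \<Rightarrow> bool" where
  "generalized_nash_equilibrium G b \<longleftrightarrow>
     feasible G b \<and> (\<forall>n. F_user_exists G n b) \<and>
     (\<forall>n d. feasible G (deviate b n d) \<and> F_user_exists G n (deviate b n d) \<longrightarrow>
            F_user G n b \<le> F_user G n (deviate b n d))"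

end

theory Submission
  imports Defs
begin

text \<open>The game has an exact potential: when only user \<open>n\<close> deviates, the aggregate cost and the
  cost of user \<open>n\<close> change by the same amount, pointwise in time and on the sample space. All costs are
  essentially bounded, so this passes to expectations and to time averages; a deviation that
  helped user \<open>n\<close> would therefore lower the aggregate cost below its minimum.\<close>

text \<open>Chosen instead of integrability because it is closed under products as well as sums, and
  the costs multiply prices by demands. The bound is only almost sure, as are all constraints of the
  game.\<close>

definition ess_bounded :: "'w measure \<Rightarrow> ('w \<Rightarrow> real) \<Rightarrow> bool" where
  "ess_bounded M f \<longleftrightarrow> f \<in> borel_measurable M \<and> (\<exists>C. AE w in M. \<bar>f w\<bar> \<le> C)"

lemma ess_boundedI:
  assumes "f \<in> borel_measurable M" "AE w in M. l \<le> f w \<and> f w \<le> u"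
  shows "ess_bounded M f"
  unfolding ess_bounded_def
proof (intro conjI exI)
  show "AE w in M. \<bar>f w\<bar> \<le> \<bar>l\<bar> + \<bar>u\<bar>"
    using assms(2) by eventually_elim arith
qed fact

lemma ess_bounded_const: "ess_bounded M (\<lambda>_. c)"
  unfolding ess_bounded_def by (auto intro!: exI[of _ "\<bar>c\<bar>"])

lemma ess_bounded_add:
  assumes "ess_bounded M f" "ess_bounded M g"
  shows "ess_bounded M (\<lambda>w. f w + g w)"
proof -
  obtain C D where "AE w in M. \<bar>f w\<bar> \<le> C" "AE w in M. \<bar>g w\<bar> \<le> D"
    using assms unfolding ess_bounded_def by blast
  then have "AE w in M. \<bar>f w + g w\<bar> \<le> C + D"
    by eventually_elim arith
  then show ?thesis
    using assms unfolding ess_bounded_def by auto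
qed

lemma ess_bounded_mult:
  assumes "ess_bounded M f" "ess_bounded M g"
  shows "ess_bounded M (\<lambda>w. f w * g w)"
proof -
  obtain C D where "AE w in M. \<bar>f w\<bar> \<le> C" "AE w in M. \<bar>g w\<bar> \<le> D"
    using assms unfolding ess_bounded_def by blast
  then have "AE w in M. \<bar>f w * g w\<bar> \<le> C * D"
    by eventually_elim (simp add: abs_mult mult_mono')
  then show ?thesis
    using assms unfolding ess_bounded_def by auto
qed

lemma ess_bounded_diff:
  assumes "ess_bounded M f" "ess_bounded M g"
  shows "ess_bounded M (\<lambda>w. f w - g w)"
  using ess_bounded_add[OF assms(1) ess_bounded_mult[OF ess_bounded_const[of M "-1"] assms(2)]]
  by simp

lemma ess_bounded_sum:
  assumes "\<And>i. i \<in> I \<Longrightarrow> ess_bounded M (f i)"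
  shows "ess_bounded M (\<lambda>w. \<Sum>i\<in>I. f i w)"
  using assms
  by (induction I rule: infinite_finite_induct) (auto intro: ess_bounded_const ess_bounded_add)

lemma (in finite_measure) integrable_ess_bounded:
  assumes "ess_bounded M f"
  shows "integrable M f"
  using assms unfolding ess_bounded_def
  by (auto intro: integrable_const_bound simp flip: real_norm_def)

lemma ess_bounded_vec_nth:
  fixes f :: "'w \<Rightarrow> real ^ 'n::finite"
  assumes "f \<in> borel_measurable M" "AE w in M. l \<le> f w \<and> f w \<le> u"
  shows "ess_bounded M (\<lambda>w. f w $ i)"
proof (rule ess_boundedI)
  show "(\<lambda>w. f w $ i) \<in> borel_measurable M"
    \<comment> \<open>A coordinate is the inner product with a unit vector, which gives its
      measurability.\<close>
    using borel_measurable_inner[OF assms(1) borel_measurable_const[of "axis i 1"]]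
    by (simp add: inner_axis)
  show "AE w in M. l $ i \<le> f w $ i \<and> f w $ i \<le> u $ i"
    using assms(2) by eventually_elim (simp add: less_eq_vec_def)
qed

context
  fixes G :: "('w, 'n::finite) storage_game"
  assumes valid: "valid_data G"
begin

lemma ess_bounded_data:
  "ess_bounded (sample_space G) (\<lambda>w. active_load G t w $ i)"
  "ess_bounded (sample_space G) (regulation G t)"
  "ess_bounded (sample_space G) (c0 G t)"
  "ess_bounded (sample_space G) (cp G t)"
  "ess_bounded (sample_space G) (cr G t)"
proof -
  have meas:
    "active_load G t \<in> borel_measurable (sample_space G)"
    "regulation G t \<in> borel_measurable (sample_space G)"
    "c0 G t \<in> borel_measurable (sample_space G)"
    "cp G t \<in> borel_measurable (sample_space G)"
    "cr G t \<in> borel_measurable (sample_space G)"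
    using valid unfolding valid_data_def by blast+
  have bounds: "AE w in sample_space G. \<forall>t.
      l_min G \<le> active_load G t w \<and> active_load G t w \<le> l_max G \<and>
      q_min G \<le> reactive_load G t w \<and> reactive_load G t w \<le> q_max G \<and>
      regulation G t w \<in> {-1, 1} \<and>
      c0_min G \<le> c0 G t w \<and> c0 G t w \<le> c0_max G \<and>
      cp_min G \<le> cp G t w \<and> cp G t w \<le> cp_max G \<and>
      cr_min G \<le> cr G t w \<and> cr G t w \<le> cr_max G"
    using valid unfolding valid_data_def by blast
  show "ess_bounded (sample_space G) (\<lambda>w. active_load G t w $ i)"
    by (rule ess_bounded_vec_nth[OF meas(1)]) (use bounds in eventually_elim, blast)
  have "AE w in sample_space G. - 1 \<le> regulation G t w \<and> regulation G t w \<le> 1"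
    using bounds
  proof eventually_elim
    case (elim w)
    then have "regulation G t w \<in> {-1, 1}"
      by blast
    then show ?case
      by auto
  qed
  with meas(2) show "ess_bounded (sample_space G) (regulation G t)"
    by (rule ess_boundedI)
  show "ess_bounded (sample_space G) (c0 G t)"
    by (rule ess_boundedI[OF meas(3)]) (use bounds in eventually_elim, blast)
  show "ess_bounded (sample_space G) (cp G t)"
    by (rule ess_boundedI[OF meas(4)]) (use bounds in eventually_elim, blast)
  show "ess_bounded (sample_space G) (cr G t)"
    by (rule ess_boundedI[OF meas(5)]) (use bounds in eventually_elim, blast)
qed

lemma ess_bounded_charge:
  assumes "feasible G b"
  shows "ess_bounded (sample_space G) (\<lambda>w. b t w $ i)"
proof (rule ess_bounded_vec_nth)
  show "b t \<in> borel_measurable (sample_space G)"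
    using assms unfolding feasible_def by blast
  have "AE w in sample_space G. \<forall>t. b_min G \<le> b t w \<and> b t w \<le> b_max G"
    using assms unfolding feasible_def by (auto elim: eventually_mono)
  then show "AE w in sample_space G. b_min G \<le> b t w \<and> b t w \<le> b_max G"
    by eventually_elim blast
qed

text \<open>Both costs are polynomials in prices, signal, loads and charges, each of which is
  essentially bounded, and the measure is finite. This is what allows expectations of cost
  differences to be split.\<close>

lemma integrable_costs:
  assumes "feasible G b"
  shows "integrable (sample_space G) (user_cost G n b t)"
    and "integrable (sample_space G) (aggregate_cost G b t)"
proof -
  interpret prob_space "sample_space G"
    using valid unfolding valid_data_def by blast
  note bounded = ess_bounded_data ess_bounded_charge[OF assms] ess_bounded_const
    ess_bounded_add ess_bounded_diff ess_bounded_mult ess_bounded_sum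
  have demand: "ess_bounded (sample_space G) (\<lambda>w. net_demand G b t w $ i)" for i
    unfolding net_demand_def vector_add_component by (intro bounded)
  have "ess_bounded (sample_space G) (user_cost G n b t)"
    unfolding user_cost_def[abs_def] by (intro bounded demand)
  then show "integrable (sample_space G) (user_cost G n b t)"
    by (rule integrable_ess_bounded)
  \<comment> \<open>Squares and halvings are rewritten as products, so that the closure rules for
    products and constants apply.\<close>
  have "ess_bounded (sample_space G) (aggregate_cost G b t)"
    unfolding aggregate_cost_def[abs_def] power2_eq_square divide_inverse
    by (intro bounded demand)
  then show "integrable (sample_space G) (aggregate_cost G b t)"
    by (rule integrable_ess_bounded)
qed

end

text \<open>Let \<open>p\<close> be the demand of user \<open>n\<close>, \<open>P\<close> the total
  demand of the others and \<open>Q\<close> their separable terms. The halves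
  \<open>cp * (p + P)^2 / 2\<close> and \<open>cp * p^2 / 2\<close> add up to
  \<open>cp * (p + P) * p + cp * P^2 / 2\<close>. Hence the aggregate cost is the cost of user
  \<open>n\<close> plus \<open>cp * P^2 / 2 + Q\<close>, and this remainder does not depend on the
  charge of user \<open>n\<close>.\<close>

lemma aggregate_cost_deviate:
  "aggregate_cost G (deviate b n d) t w - aggregate_cost G b t w
   = user_cost G n (deviate b n d) t w - user_cost G n b t w"
proof -
  let ?b' = "deviate b n d"
  define P where "P = (\<Sum>i\<in>UNIV - {n}. net_demand G b t w $ i)"
  define Q where "Q = (\<Sum>i\<in>UNIV - {n}. c0 G t w * net_demand G b t w $ i
    + cp G t w * (net_demand G b t w $ i)\<^sup>2 / 2 - regulation G t w * cr G t w * b t w $ i)"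
  have split: "(\<Sum>i\<in>UNIV. h i) = h n + (\<Sum>i\<in>UNIV - {n}. h i)" for h :: "_ \<Rightarrow> real"
    by (rule sum.remove) auto
  have "(\<Sum>i\<in>UNIV - {n}. net_demand G ?b' t w $ i) = P"
    unfolding P_def by (rule sum.cong) (auto simp: net_demand_def deviate_def)
  moreover have "(\<Sum>i\<in>UNIV - {n}. c0 G t w * net_demand G ?b' t w $ i
    + cp G t w * (net_demand G ?b' t w $ i)\<^sup>2 / 2 - regulation G t w * cr G t w * ?b' t w $ i) = Q"
    unfolding Q_def by (rule sum.cong) (auto simp: net_demand_def deviate_def)
  ultimately show ?thesis
    unfolding aggregate_cost_def user_cost_def split P_def[symmetric] Q_def[symmetric]
    by (simp add: field_simps power2_eq_square)
qed

text \<open>Solved for the aggregate mean of the deviation, so that its convergence can be deduced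
  from that of the three means on the right.\<close>

lemma mean_cost_aggregate_deviate:
  assumes "valid_data G" "feasible G b" "feasible G (deviate b n d)"
  shows "mean_cost G (aggregate_cost G (deviate b n d)) T
    = mean_cost G (aggregate_cost G b) T
      + (mean_cost G (user_cost G n (deviate b n d)) T - mean_cost G (user_cost G n b) T)"
proof -
  let ?E = "integral\<^sup>L (sample_space G)" and ?b' = "deviate b n d"
  have "?E (aggregate_cost G ?b' t) = ?E (aggregate_cost G b t)
      + (?E (user_cost G n ?b' t) - ?E (user_cost G n b t))" for t
  proof -
    have "?E (\<lambda>w. aggregate_cost G ?b' t w - aggregate_cost G b t w)
        = ?E (\<lambda>w. user_cost G n ?b' t w - user_cost G n b t w)"
      by (simp only: aggregate_cost_deviate)
    then show ?thesis
      using integrable_costs[OF assms(1,2)] integrable_costs[OF assms(1,3)] by simp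
  qed
  \<comment> \<open>Only linearity is used, so \<open>T = 0\<close>, where the factor
    \<open>1 / real T\<close> is 0, is no special case.\<close>
  then show ?thesis
    unfolding mean_cost_def by (simp only: sum.distrib sum_subtractf distrib_left right_diff_distrib)
qed

theorem proposition1:
  fixes G :: "('w, 'n::finite) storage_game"
    and b :: "('w, 'n) charging"
  assumes "valid_grid G"
    and "valid_data G"
    and "aggregate_minimizer G b"
    and "\<And>n. F_user_exists G n b"
  shows "generalized_nash_equilibrium G b"
proof -
  have feas: "feasible G b" and agg: "F_agg_exists G b"
    and minimal: "\<And>b'. feasible G b' \<Longrightarrow> F_agg_exists G b' \<Longrightarrow> F_agg G b \<le> F_agg G b'"
    using assms(3) unfolding aggregate_minimizer_def by blast+
  have "F_user G n b \<le> F_user G n (deviate b n d)"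
    if feas': "feasible G (deviate b n d)" and user': "F_user_exists G n (deviate b n d)" for n d
  proof -
    let ?b' = "deviate b n d"
    have "mean_cost G (aggregate_cost G b) \<longlonglongrightarrow> F_agg G b"
      "mean_cost G (user_cost G n b) \<longlonglongrightarrow> F_user G n b"
      "mean_cost G (user_cost G n ?b') \<longlonglongrightarrow> F_user G n ?b'"
      using agg assms(4) user'
      unfolding F_agg_exists_def F_user_exists_def F_agg_def F_user_def convergent_LIMSEQ_iff
      by blast+
    \<comment> \<open>Minimality compares \<open>b\<close> only with sequences whose aggregate
      average converges. The potential identity supplies this convergence for the deviation,
      together with the value of the limit.\<close>
    then have lim: "mean_cost G (aggregate_cost G ?b')
        \<longlonglongrightarrow> F_agg G b + (F_user G n ?b' - F_user G n b)"
      unfolding mean_cost_aggregate_deviate[OF assms(2) feas feas', abs_def]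
      by (intro tendsto_intros)
    then have "F_agg_exists G ?b'"
      unfolding F_agg_exists_def by (rule convergentI)
    moreover have "F_agg G ?b' = F_agg G b + (F_user G n ?b' - F_user G n b)"
      unfolding F_agg_def[of G ?b'] using lim by (rule limI)
    \<comment> \<open>Cancelling \<open>F_agg G b\<close> in the minimality inequality leaves a
      nonnegative change in the cost of user \<open>n\<close>.\<close>
    ultimately show ?thesis
      using minimal[OF feas'] by simp
  qed
  then show ?thesis
    unfolding generalized_nash_equilibrium_def using feas assms(4) by blast
qed

end
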